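(* Let $f:\mathbb{R}^n\to\mathbb{R}$ be convex. Let $x\in\mathbb{R}^n$ be any point at which $f$ is twice differentiable in the following sense: $f$ is differentiable at $x$ and there is a symmetric $n\times n$ matrix $D^2f(x)$ such that $$\lim_{y\to x}\frac{f(y)-f(x)-Df(x)(y-x)-\frac12 (y-x)^T D^2f(x)(y-x)}{|y-x|^2}=0.$$ Then $$\lim_{y\to x}\ \sup_{\sigma_y\in\partial f(y)}\frac{|\sigma_y-Df(x)-D^2f(x)(y-x)|}{|y-x|}=0.$$
   Context: For a convex function $f:\mathbb{R}^n\to\mathbb{R}$ and $y\in\mathbb{R}^n$, the subdifferential is $\partial f(y)=\{v\in\mathbb{R}^n:\ f(z)\ge f(y)+\langle v,z-y\rangle\text{ for all }z\in\mathbb{R}^n\}$ (it is always nonempty). $Df(x)$ is the derivative of $f$ at $x$; in the difference $\sigma_y-Df(x)-D^2f(x)(y-x)$ it is identified with the gradient vector $\nabla f(x)\in\mathbb{R}^n$. *)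

theory Defs
  imports "HOL-Analysis.Analysis"
begin

definition subdifferential :: "('a::real_inner \<Rightarrow> real) \<Rightarrow> 'a \<Rightarrow> 'a set" where
  "subdifferential f y = {v. \<forall>z. f z \<ge> f y + v \<bullet> (z - y)}"

end

theory Submission
  imports Defs
begin

text \<open>Let \<open>A\<close> be the Hessian at \<open>x\<close> and write \<open>f (x + h)\<close> as its second-order expansion plus
  a remainder \<open>r h\<close>. If \<open>\<sigma>\<close> is a subgradient at \<open>x + h\<close> and \<open>w = \<sigma> - Df - A h\<close>, the subgradient
  inequality between \<open>x + h\<close> and \<open>x + h + k\<close> becomes
  \<open>w \<bullet> k \<le> r (h + k) - r h + (k \<bullet> A k) / 2\<close>. Testing it with \<open>k\<close> parallel to \<open>w\<close> and of norm
  \<open>t |h|\<close>, for a fixed small \<open>t\<close>, gives \<open>|w| / |h| \<le> 5 \<epsilon> / t + C t / 2\<close> as soon as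
  \<open>|r u| \<le> \<epsilon> |u|\<^sup>2\<close> on the ball of radius \<open>2 |h|\<close>.\<close>

text \<open>A hyperplane separates \<open>(y, f y)\<close> from the convex strict epigraph of
  \<open>f\<close>. As \<open>f\<close> is finite everywhere, this hyperplane cannot be vertical, so
  it is the graph of an affine minorant touching \<open>f\<close> at \<open>y\<close>.\<close>

lemma subdifferential_nonempty:
  fixes f :: "'a::euclidean_space \<Rightarrow> real"
  assumes "convex_on UNIV f"
  shows "subdifferential f y \<noteq> {}"
proof -
  define S where "S = {p :: 'a \<times> real. f (fst p) < snd p}"
  have "convex S"
    unfolding convex_alt
  proof (intro ballI allI impI)
    fix p q and u :: real
    assume pq: "p \<in> S" "q \<in> S" and u: "0 \<le> u \<and> u \<le> 1"
    have "f ((1 - u) *\<^sub>R fst p + u *\<^sub>R fst q) \<le> (1 - u) * f (fst p) + u * f (fst q)"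
      using convex_onD[OF assms] u by auto
    also have "\<dots> < (1 - u) * snd p + u * snd q"
    \<comment> \<open>Strictness comes from the \<open>q\<close> term when \<open>u > 0\<close>; for
      \<open>u = 0\<close> the combination is \<open>p\<close> itself.\<close>
    proof (cases "u = 0")
      case False
      then have "u * f (fst q) < u * snd q"
        using u pq by (simp add: S_def)
      moreover have "(1 - u) * f (fst p) \<le> (1 - u) * snd p"
        using u pq by (intro mult_left_mono) (auto simp: S_def)
      ultimately show ?thesis by simp
    qed (use pq in \<open>simp add: S_def\<close>)
    finally show "(1 - u) *\<^sub>R p + u *\<^sub>R q \<in> S"
      by (simp add: S_def)
  qed
  moreover have "(y, f y + 1) \<in> S" "{(y, f y)} \<inter> S = {}"
    by (auto simp: S_def)
  ultimately have "\<exists>a b. a \<noteq> 0 \<and> (\<forall>p\<in>{(y, f y)}. a \<bullet> p \<le> b) \<and> (\<forall>p\<in>S. a \<bullet> p \<ge> b)"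
    by (intro separating_hyperplane_sets) auto
  then obtain a b where ab: "a \<noteq> 0" "a \<bullet> (y, f y) \<le> b" "\<forall>p\<in>S. a \<bullet> p \<ge> b"
    by blast
  obtain c d where a: "a = (c, d)" by (cases a)
  have sep: "c \<bullet> y + d * f y \<le> c \<bullet> z + d * s" if "f z < s" for z s
    using ab that by (force simp: a S_def)
  \<comment> \<open>Points vertically above \<open>(y, f y)\<close> give the sign of
    \<open>d\<close>.\<close>
  have "d \<ge> 0"
    using sep[of y "f y + 1"] by (simp add: algebra_simps)
  moreover have "d \<noteq> 0"
  proof
    assume d: "d = 0"
    \<comment> \<open>A vertical hyperplane fails at a point on its wrong side: moving from
      \<open>y\<close> by \<open>- c\<close> lowers the functional by
      \<open>c \<bullet> c\<close>.\<close>
    with sep[of "y - c" "f (y - c) + 1"] have "c \<bullet> c \<le> 0"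
      by (simp add: algebra_simps)
    then have "c = 0"
      by (metis inner_gt_zero_iff not_le)
    with ab d a show False by (simp add: zero_prod_def)
  qed
  ultimately have d: "d > 0" by simp
  have "f y + (- c /\<^sub>R d) \<bullet> (z - y) \<le> f z" for z
  \<comment> \<open>The separation only covers heights \<open>s\<close> strictly above
    \<open>f z\<close>; letting \<open>s\<close> decrease to \<open>f z\<close> gives the
    subgradient inequality.\<close>
  proof (rule dense_ge)
    fix s assume "f z < s"
    from sep[OF this] d show "f y + (- c /\<^sub>R d) \<bullet> (z - y) \<le> s"
      by (simp add: field_simps inner_diff_right)
  qed
  then have "- c /\<^sub>R d \<in> subdifferential f y"
    unfolding subdifferential_def by blast
  then show ?thesis by blast
qed

text \<open>A quantitative estimate at a single \<open>y\<close>, with no limit taken. Keeping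
  \<open>t\<close> and \<open>e\<close> independent allows \<open>t\<close> to be fixed first and
  \<open>e\<close> to be chosen small relative to it.\<close>

lemma subgradient_deviation_bound:
  fixes f :: "'a::real_inner \<Rightarrow> real" and A :: "'a \<Rightarrow> 'a"
  defines "r \<equiv> \<lambda>u x g. f u - f x - g \<bullet> (u - x) - 1 / 2 * ((u - x) \<bullet> A (u - x))"
  assumes A: "linear A" "\<And>u v. u \<bullet> A v = A u \<bullet> v" "\<And>u. norm (A u) \<le> C * norm u"
    and remainder: "\<And>u. norm (u - x) \<le> 2 * norm (y - x) \<Longrightarrow> \<bar>r u x g\<bar> \<le> e * (norm (u - x))\<^sup>2"
    and \<sigma>: "\<sigma> \<in> subdifferential f y"
    and t: "0 < t" "t \<le> 1" and "e \<ge> 0" "y \<noteq> x"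
  shows "norm (\<sigma> - g - A (y - x)) / norm (y - x) \<le> 5 * e / t + C * t / 2"
proof (cases "\<sigma> - g - A (y - x) = 0")
  case True
  \<comment> \<open>Here the left side vanishes, so only the sign of \<open>C\<close> is at stake;
    it follows from the operator bound at a nonzero vector.\<close>
  have "0 \<le> norm (A (y - x))" by simp
  also have "\<dots> \<le> C * norm (y - x)" by (rule A)
  finally have "C \<ge> 0"
    using \<open>y \<noteq> x\<close> by (simp add: zero_le_mult_iff)
  with True assms show ?thesis by simp
next
  case False
  define h where "h = y - x"
  define w where "w = \<sigma> - g - A h"
  define k where "k = (t * norm h / norm w) *\<^sub>R w"
  have pos: "norm h > 0" "norm w > 0"
    using False \<open>y \<noteq> x\<close> by (auto simp: h_def w_def)
  then have nk: "norm k = t * norm h"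
    using t by (simp add: k_def)
  have wk: "w \<bullet> k = t * norm h * norm w"
    using pos by (simp add: k_def dot_square_norm power2_eq_square)
  \<comment> \<open>Symmetry of \<open>A\<close> merges the two cross terms; the result
    \<open>A h \<bullet> k\<close> is the part of \<open>w \<bullet> k\<close> coming from the
    Hessian.\<close>
  have expand: "(h + k) \<bullet> A (h + k) = h \<bullet> A h + 2 * (A h \<bullet> k) + k \<bullet> A k"
    using A(2)[of k h] A(2)[of h k]
    by (simp add: linear_add[OF A(1)] inner_add_left inner_add_right inner_commute)
  have "f (y + k) \<ge> f y + \<sigma> \<bullet> k"
    using \<sigma> by (auto simp: subdifferential_def dest: spec[of _ "y + k"])
  moreover have "y + k - x = h + k"
    by (simp add: h_def)
  ultimately have main: "w \<bullet> k \<le> r (y + k) x g - r y x g + k \<bullet> A k / 2"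
    unfolding r_def
    by (simp only: h_def[symmetric] expand) (simp add: w_def inner_diff_left inner_add_right add_divide_distrib)
  \<comment> \<open>The condition \<open>t \<le> 1\<close> keeps \<open>h + k\<close> in the ball of
    radius \<open>2 * norm h\<close>, where the remainder is controlled.\<close>
  have "t * norm h \<le> norm h"
    using t pos by simp
  then have le: "norm (h + k) \<le> 2 * norm h"
    using norm_triangle_ineq[of h k] nk by linarith
  have "\<bar>r (y + k) x g\<bar> \<le> e * (norm (h + k))\<^sup>2"
    using remainder[of "y + k"] le by (simp add: h_def algebra_simps)
  also have "\<dots> \<le> e * (2 * norm h)\<^sup>2"
    using le \<open>e \<ge> 0\<close> by (intro mult_left_mono power_mono) auto
  finally have r1: "\<bar>r (y + k) x g\<bar> \<le> 4 * e * (norm h)\<^sup>2"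
    by (simp add: power_mult_distrib)
  have r2: "\<bar>r y x g\<bar> \<le> e * (norm h)\<^sup>2"
    using remainder[of y] by (simp add: h_def)
  have "k \<bullet> A k \<le> norm k * norm (A k)"
    by (rule norm_cauchy_schwarz)
  also have "\<dots> \<le> norm k * (C * norm k)"
    by (intro mult_left_mono A) auto
  finally have "k \<bullet> A k \<le> C * t\<^sup>2 * (norm h)\<^sup>2"
    by (simp add: nk power2_eq_square algebra_simps)
  \<comment> \<open>The constant 5 is 4 from the remainder at \<open>y + k\<close> plus 1 from the
    remainder at \<open>y\<close>.\<close>
  with main r1 r2 wk have "t * norm h * norm w \<le> 5 * e * (norm h)\<^sup>2 + C * t\<^sup>2 * (norm h)\<^sup>2 / 2"
    by linarith
  also have "\<dots> = t * norm h * ((5 * e / t + C * t / 2) * norm h)"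
    using t by (simp add: field_simps power2_eq_square)
  finally have "norm w \<le> (5 * e / t + C * t / 2) * norm h"
    using t pos by (simp add: mult_le_cancel_left)
  then show ?thesis
    using pos by (simp add: divide_le_eq w_def h_def)
qed

theorem theorem1p2:
  fixes f :: "real ^ 'n \<Rightarrow> real"
    and x Df :: "real ^ 'n"
    and D2f :: "real ^ 'n ^ 'n"
  assumes "convex_on UNIV f"
    and "GDERIV f x :> Df"
    and "transpose D2f = D2f"
    and "((\<lambda>y. (f y - f x - Df \<bullet> (y - x) - 1 / 2 * ((y - x) \<bullet> (D2f *v (y - x)))) / (norm (y - x))\<^sup>2)
           \<longlongrightarrow> 0) (at x)"
  shows "((\<lambda>y. SUP \<sigma>\<in>subdifferential f y. ereal (norm (\<sigma> - Df - D2f *v (y - x)) / norm (y - x)))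
           \<longlongrightarrow> 0) (at x)"
proof -
  define q where "q = (\<lambda>y \<sigma>. norm (\<sigma> - Df - D2f *v (y - x)) / norm (y - x))"
  define r where
    "r = (\<lambda>y. f y - f x - Df \<bullet> (y - x) - 1 / 2 * ((y - x) \<bullet> (D2f *v (y - x))))"
  obtain C where C: "C > 0" "\<And>u. norm (D2f *v u) \<le> C * norm u"
    using linear_bounded_pos[OF matrix_vector_mul_linear[of D2f]] by blast
  have sym: "u \<bullet> (D2f *v v) = (D2f *v u) \<bullet> v" for u v
    using dot_lmul_matrix[of u D2f v] assms(3) transpose_matrix_vector[of D2f u] by simp
  have small: "\<forall>\<^sub>F y in at x. \<forall>\<sigma>\<in>subdifferential f y. q y \<sigma> \<le> \<eta>" if "\<eta> > 0" for \<eta>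
  proof -
    \<comment> \<open>With these choices \<open>C * t / 2\<close> is at most
      \<open>\<eta> / 2\<close>, and \<open>5 * e / t\<close> equals
      \<open>\<eta> / 2\<close>.\<close>
    define t where "t = min 1 (\<eta> / C)"
    define e where "e = \<eta> * t / 10"
    have t: "0 < t" "t \<le> 1" "C * t \<le> \<eta>"
      using C \<open>\<eta> > 0\<close> by (auto simp: t_def min_def field_simps)
    then have "e > 0"
      using \<open>\<eta> > 0\<close> by (simp add: e_def)
    then have "\<forall>\<^sub>F y in at x. dist (r y / (norm (y - x))\<^sup>2) 0 < e"
      using assms(4) unfolding r_def by (rule tendstoD[rotated])
    then obtain d where d: "d > 0"
      "\<And>u. u \<noteq> x \<Longrightarrow> dist u x < d \<Longrightarrow> \<bar>r u / (norm (u - x))\<^sup>2\<bar> < e"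
      by (auto simp: eventually_at)
    have rem: "\<bar>r u\<bar> \<le> e * (norm (u - x))\<^sup>2" if "norm (u - x) < d" for u
    proof (cases "u = x")
      case False
      with d(2)[of u] that show ?thesis
        by (simp add: dist_norm divide_less_eq)
    qed (simp add: r_def)
    \<comment> \<open>Halving \<open>d\<close> makes the remainder bound valid on the whole ball of
      radius \<open>2 * norm (y - x)\<close>.\<close>
    have "q y \<sigma> \<le> \<eta>" if y: "y \<noteq> x" "dist y x < d / 2" and \<sigma>: "\<sigma> \<in> subdifferential f y" for y \<sigma>
    proof -
      have "q y \<sigma> \<le> 5 * e / t + C * t / 2"
        unfolding q_def
      proof (rule subgradient_deviation_bound[where f = f])
        fix u assume "norm (u - x) \<le> 2 * norm (y - x)"
        then show "\<bar>f u - f x - Df \<bullet> (u - x) - 1 / 2 * ((u - x) \<bullet> (D2f *v (u - x)))\<bar>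
            \<le> e * (norm (u - x))\<^sup>2"
          using rem[of u] y unfolding r_def dist_norm by linarith
      qed (use C sym t \<open>e > 0\<close> y \<sigma> in auto)
      also have "\<dots> \<le> \<eta>"
        using t by (simp add: e_def)
      finally show ?thesis .
    qed
    then show ?thesis
      unfolding eventually_at using \<open>d > 0\<close> by (intro exI[of _ "d / 2"]) auto
  qed
  have "((\<lambda>y. SUP \<sigma>\<in>subdifferential f y. ereal (q y \<sigma>)) \<longlongrightarrow> 0) (at x)"
  proof (rule order_tendstoI)
    fix a :: ereal assume "a < 0"
    \<comment> \<open>An empty supremum in \<open>ereal\<close> would be minus infinity; existence
      of a subgradient makes the supremum nonnegative.\<close>
    have "a < (SUP \<sigma>\<in>subdifferential f y. ereal (q y \<sigma>))" for y
    proof -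
      obtain \<sigma> where "\<sigma> \<in> subdifferential f y"
        using subdifferential_nonempty[OF assms(1)] by blast
      moreover have "a < ereal (q y \<sigma>)"
        using \<open>a < 0\<close> by (rule less_le_trans) (simp add: q_def)
      ultimately show ?thesis
        by (auto simp: less_SUP_iff)
    qed
    then show "\<forall>\<^sub>F y in at x. a < (SUP \<sigma>\<in>subdifferential f y. ereal (q y \<sigma>))"
      by simp
  next
    fix a :: ereal assume "0 < a"
    \<comment> \<open>The supremum inherits only a weak bound, so a real \<open>\<eta>\<close>
      strictly below \<open>a\<close> is inserted; this also covers infinite
      \<open>a\<close>.\<close>
    then obtain \<eta> where \<eta>: "0 < ereal \<eta>" "ereal \<eta> < a"
      using ereal_dense2 by blast
    then have "\<forall>\<^sub>F y in at x. \<forall>\<sigma>\<in>subdifferential f y. q y \<sigma> \<le> \<eta>"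
      by (intro small) simp
    then show "\<forall>\<^sub>F y in at x. (SUP \<sigma>\<in>subdifferential f y. ereal (q y \<sigma>)) < a"
    proof (rule eventually_mono)
      fix y assume "\<forall>\<sigma>\<in>subdifferential f y. q y \<sigma> \<le> \<eta>"
      then have "(SUP \<sigma>\<in>subdifferential f y. ereal (q y \<sigma>)) \<le> ereal \<eta>"
        by (intro SUP_least) simp
      then show "(SUP \<sigma>\<in>subdifferential f y. ereal (q y \<sigma>)) < a"
        using \<eta>(2) by (rule le_less_trans)
    qed
  qed
  then show ?thesis
    unfolding q_def .
qed

end
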